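(* For every integer $n\ge1$, the $n$th cumulant of the main-lobe RFI brightness temperature $T_{(ml)}$ is $$k_{n}^{(ml)}=40^{2}\,g_{(ml)}^n\,\omega^{n}\,\lambda_c\,p_n(\lambda_{BS})\,d_{(ml)}^{-n\alpha},$$ where $p_n(\lambda_{BS})=(2b_0)^n\,\Gamma(n+1)\,L_n^{(-1)}(-\lambda_{BS})$ under Rayleigh fading, and $p_n(\lambda_{BS})=\sum_{i=1}^{n}B_{n,i}(a_1,\dots,a_{n-i+1})\lambda_{BS}^i$ under shadowed Rician fading.
   Context: Constants $\omega>0$, $\alpha>2$, $\lambda_c>0$ (cluster intensity per km$^2$), $\lambda_{BS}>0$, $g_{(ml)}>0$, Earth radius $r_e>0$ and satellite distance to the Earth's center $h>r_e$ are given. $d_{(ml)}$ is the positive root $d$ of $d^2+2d\,r_e\cos(40^\circ)+r_e^2-h^2=0$. The main-lobe footprint has area $40^2$ km$^2$ and contains $M\sim\mathrm{Pois}(40^2\lambda_c)$ clusters, all at distance $d_{(ml)}$ from the satellite. $T_{(ml)}=\sum_{i=1}^{M}\sum_{j=1}^{N_i}g_{(ml)}\omega|H_{ij}|^2d_{(ml)}^{-\alpha}$, with $N_i\sim\mathrm{Pois}(\lambda_{BS})$ i.i.d., channel power gains $|H_{ij}|^2$ i.i.d., and all of $M$, $N_i$, $|H_{ij}|^2$ independent. The $n$th cumulant of a random variable $X$ is the $n$th derivative at $\eta=0$ of $\log\mathbb{E}[e^{\eta X}]$. Rayleigh fading: $|H|^2$ is exponential with mean $2b_0$. Shadowed Rician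 fading with parameters $(\Omega,2b_0,m)$, $b_0,m,\Omega>0$: $|H|^2$ has density $\frac{1}{2b_0}\left(\frac{2b_0m}{2b_0m+\Omega}\right)^m e^{-t/(2b_0)}\,{}_1F_1\left(m;1;\frac{\Omega t}{2b_0(2b_0m+\Omega)}\right)$ on $t>0$. $L_{n}^{(a)}(v)=\sum_{i=0}^{n}(-1)^{i}\binom{n+a}{n-i}\frac{v^i}{i!}$ are generalized Laguerre polynomials; $B_{n,i}$ are the partial (exponential) Bell polynomials; $a_n=\left(\frac{2b_0m}{2b_0m+\Omega}\right)^m(2b_0)^n\Gamma(n+1)\,{}_2F_1\left(m,n+1;1;\frac{\Omega}{2b_0m+\Omega}\right)$ is the $n$th moment of $|H|^2$ under shadowed Rician fading. *)

theory Defs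
  imports "HOL-Probability.Probability"
begin

definition hypergeo :: "real list \<Rightarrow> real list \<Rightarrow> real \<Rightarrow> real" where
  "hypergeo as bs z = eval_fps (fps_hypergeo as bs 1) z"

abbreviation hypergeo_1F1 :: "real \<Rightarrow> real \<Rightarrow> real \<Rightarrow> real" where
  "hypergeo_1F1 a b z \<equiv> hypergeo [a] [b] z"

abbreviation hypergeo_2F1 :: "real \<Rightarrow> real \<Rightarrow> real \<Rightarrow> real \<Rightarrow> real" where
  "hypergeo_2F1 a b c z \<equiv> hypergeo [a, b] [c] z"

definition gen_laguerre :: "nat \<Rightarrow> real \<Rightarrow> real \<Rightarrow> real" where
  "gen_laguerre n a v =
     (\<Sum>i = 0..n. (-1) ^ i * ((real n + a) gchoose (n - i)) * v ^ i / fact i)"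

text \<open>
  The partial exponential Bell polynomial $B_{n,k}(x_1,\dots,x_{n-k+1})$ for \<open>1 \<le> k \<le> n\<close>: the sum
  runs over the multiplicities $(j_1,\dots,j_{n-k+1})$ with $\sum j_i = k$ and $\sum i\,j_i = n$.
  The bound \<open>j i \<le> k\<close> follows from the first constraint and only makes the index set finite.
\<close>

definition partial_bell :: "nat \<Rightarrow> nat \<Rightarrow> (nat \<Rightarrow> real) \<Rightarrow> real" where
  "partial_bell n k x =
     (\<Sum>j | j \<in> {1..n - k + 1} \<rightarrow>\<^sub>E {0..k} \<and> (\<Sum>i = 1..n - k + 1. j i) = k
             \<and> (\<Sum>i = 1..n - k + 1. i * j i) = n.
        fact n / (\<Prod>i = 1..n - k + 1. fact (j i)) *
          (\<Prod>i = 1..n - k + 1. (x i / fact i) ^ j i))"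

definition cgf :: "'a measure \<Rightarrow> ('a \<Rightarrow> real) \<Rightarrow> real \<Rightarrow> real" where
  "cgf P X \<eta> = ln (\<integral>x. exp (\<eta> * X x) \<partial>P)"

text \<open>
  Integrals and derivatives are total functions here, so the existence of the expectations near
  \<open>0\<close> and of the derivatives up to order \<open>n\<close> is part of the notion.
\<close>

definition has_cumulant :: "'a measure \<Rightarrow> ('a \<Rightarrow> real) \<Rightarrow> nat \<Rightarrow> real \<Rightarrow> bool" where
  "has_cumulant P X n k \<longleftrightarrow>
     (\<exists>\<epsilon>>0. \<forall>\<eta>. \<bar>\<eta>\<bar> < \<epsilon> \<longrightarrow>
        integrable P (\<lambda>x. exp (\<eta> * X x)) \<and>
        (\<forall>i<n. (deriv ^^ i) (cgf P X) differentiable at \<eta>)) \<and>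
     (deriv ^^ n) (cgf P X) 0 = k"

definition shadowed_rician_density :: "real \<Rightarrow> real \<Rightarrow> real \<Rightarrow> real \<Rightarrow> real" where
  "shadowed_rician_density \<Omega> b0 m t =
     (if t > 0 then
        1 / (2 * b0) * ((2 * b0 * m) / (2 * b0 * m + \<Omega>)) powr m * exp (- t / (2 * b0)) *
        hypergeo_1F1 m 1 (\<Omega> * t / (2 * b0 * (2 * b0 * m + \<Omega>)))
      else 0)"

definition shadowed_rician_moment :: "real \<Rightarrow> real \<Rightarrow> real \<Rightarrow> nat \<Rightarrow> real" where
  "shadowed_rician_moment \<Omega> b0 m n =
     ((2 * b0 * m) / (2 * b0 * m + \<Omega>)) powr m * (2 * b0) ^ n * Gamma (real n + 1) *
     hypergeo_2F1 m (real n + 1) 1 (\<Omega> / (2 * b0 * m + \<Omega>))"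

definition p_rayleigh :: "real \<Rightarrow> nat \<Rightarrow> real \<Rightarrow> real" where
  "p_rayleigh b0 n l = (2 * b0) ^ n * Gamma (real n + 1) * gen_laguerre n (-1) (- l)"

definition p_shadowed_rician :: "real \<Rightarrow> real \<Rightarrow> real \<Rightarrow> nat \<Rightarrow> real \<Rightarrow> real" where
  "p_shadowed_rician \<Omega> b0 m n l =
     (\<Sum>i = 1..n. partial_bell n i (shadowed_rician_moment \<Omega> b0 m) * l ^ i)"

text \<open>
  Clusters, and the base stations inside a cluster, are numbered from \<open>0\<close>. The random variables are
  the number \<open>K\<close> of clusters, the number \<open>N i\<close> of base stations in the \<open>i\<close>-th cluster and the
  complex channel coefficients \<open>H i j\<close>.
\<close>

definition channel_gain :: "(nat \<Rightarrow> nat \<Rightarrow> 'a \<Rightarrow> complex) \<Rightarrow> nat \<Rightarrow> nat \<Rightarrow> 'a \<Rightarrow> real" where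
  "channel_gain H i j x = (cmod (H i j x))\<^sup>2"

definition mainlobe_temperature ::
  "real \<Rightarrow> real \<Rightarrow> real \<Rightarrow> real \<Rightarrow> ('a \<Rightarrow> nat) \<Rightarrow> (nat \<Rightarrow> 'a \<Rightarrow> nat) \<Rightarrow>
     (nat \<Rightarrow> nat \<Rightarrow> 'a \<Rightarrow> complex) \<Rightarrow> 'a \<Rightarrow> real" where
  "mainlobe_temperature g \<omega> \<alpha> d K N H x =
     (\<Sum>i<K x. \<Sum>j<N i x. g * \<omega> * channel_gain H i j x * d powr (- \<alpha>))"

text \<open>
  The library's \<^const>\<open>prob_space.indep_vars\<close> needs a single value type, so the counting variables
  are embedded into the reals; the embedding generates the same sigma-algebras.
\<close>

datatype source = Cluster_Count | Station_Count nat | Gain nat nat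

fun source_rv ::
  "('a \<Rightarrow> nat) \<Rightarrow> (nat \<Rightarrow> 'a \<Rightarrow> nat) \<Rightarrow> (nat \<Rightarrow> nat \<Rightarrow> 'a \<Rightarrow> complex) \<Rightarrow> source \<Rightarrow> 'a \<Rightarrow> real" where
  "source_rv K N H Cluster_Count x = real (K x)"
| "source_rv K N H (Station_Count i) x = real (N i x)"
| "source_rv K N H (Gain i j) x = channel_gain H i j x"

definition poisson_distributed :: "'a measure \<Rightarrow> ('a \<Rightarrow> nat) \<Rightarrow> real \<Rightarrow> bool" where
  "poisson_distributed P X r \<longleftrightarrow>
     X \<in> measurable P (count_space UNIV) \<and>
     distr P (count_space UNIV) X = measure_pmf (poisson_pmf r)"

definition rayleigh_fading :: "'a measure \<Rightarrow> (nat \<Rightarrow> nat \<Rightarrow> 'a \<Rightarrow> complex) \<Rightarrow> real \<Rightarrow> bool" where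
  "rayleigh_fading P H b0 \<longleftrightarrow>
     (\<forall>i j. distributed P lborel (channel_gain H i j) (exponential_density (1 / (2 * b0))))"

definition shadowed_rician_fading ::
  "'a measure \<Rightarrow> (nat \<Rightarrow> nat \<Rightarrow> 'a \<Rightarrow> complex) \<Rightarrow> real \<Rightarrow> real \<Rightarrow> real \<Rightarrow> bool" where
  "shadowed_rician_fading P H \<Omega> b0 m \<longleftrightarrow>
     (\<forall>i j. distributed P lborel (channel_gain H i j) (shadowed_rician_density \<Omega> b0 m))"

end

theory Submission
  imports Defs "HOL-Complex_Analysis.Laurent_Convergence" "HOL-Real_Asymp.Real_Asymp"
begin

text \<open>
  Conditioning twice on Poisson counts gives
  $\mathbb{E}[e^{\eta T}] = \exp(\lambda(\exp(\mu(\Phi(c\eta) - 1)) - 1))$ near \<open>0\<close>, where $\Phi$ is the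
  moment generating function of a single gain, $\lambda = 40^2\lambda_c$, $\mu = \lambda_{BS}$ and
  $c = g\omega d^{-\alpha}$. So the cumulant generating function is an affine image of the exponential
  of a power series, and by the exponential formula its Taylor coefficients are Bell polynomials in
  the moments of the gain. For Rayleigh fading the moments are $n!\,(2b_0)^n$, and $\Phi - 1$ is the
  series $\theta x/(1 - \theta x)$ with $\theta = 2b_0$; its powers have binomial coefficients, which are those of the
  Laguerre polynomial. For shadowed Rician fading the moments come from termwise integration of the
  ${}_1F_1$ series.
\<close>

subsection \<open>Power series of real functions\<close>

text \<open>
  The library proves the composition rule for complex functions only; a real series is transferred by
  viewing its coefficients as complex numbers.
\<close>

lemma has_fps_expansion_compose_real:
  fixes f g :: "real \<Rightarrow> real"
  assumes F: "f has_fps_expansion F" and G: "g has_fps_expansion G" "fps_nth G 0 = 0"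
  shows "(\<lambda>x. f (g x)) has_fps_expansion (F oo G)"
proof -
  \<comment> \<open>\<open>C\<close> is the coefficientwise embedding of real series into complex
    ones. It preserves the radius of convergence and, at real points, the value.\<close>
  define C :: "real fps \<Rightarrow> complex fps" where "C A = Abs_fps (\<lambda>n. of_real (fps_nth A n))" for A
  have radius: "fps_conv_radius (C A) = fps_conv_radius A" for A
    unfolding fps_conv_radius_def C_def
    using conv_radius_norm[of "\<lambda>n. complex_of_real (fps_nth A n)"] conv_radius_norm[of "fps_nth A"]
    by simp
  have eval: "eval_fps (C A) (of_real x) = of_real (eval_fps A x)"
    if "ereal (norm x) < fps_conv_radius A" for A x
  proof -
    have "(\<lambda>n. fps_nth A n * x ^ n) sums eval_fps A x"
      using summable_fps[OF that] by (simp add: eval_fps_def summable_sums)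
    then have "(\<lambda>n. complex_of_real (fps_nth A n * x ^ n)) sums of_real (eval_fps A x)"
      by (rule sums_of_real)
    then show ?thesis
      by (simp add: eval_fps_def C_def sums_iff)
  qed
  have near: "eventually (\<lambda>x::real. ereal (norm x) < fps_conv_radius A) (nhds 0)"
    if "fps_conv_radius A > 0" for A :: "real fps"
    using eventually_nhds_in_open[of "eball 0 (fps_conv_radius A)" "0::real"] that
    by (simp add: zero_ereal_def)
  \<comment> \<open>Each coefficient of a composition is a finite sum of coefficients of
    \<open>F\<close> times coefficients of powers of \<open>G\<close>, so a ring homomorphism such
    as \<open>C\<close> commutes with it.\<close>
  have compose: "C (F oo G) = C F oo C G"
  proof -
    have "C (A * B) = C A * C B" for A B
      by (simp add: fps_eq_iff C_def fps_mult_nth)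
    moreover have "C 1 = 1"
      by (simp add: fps_eq_iff C_def)
    ultimately have "C (A ^ n) = C A ^ n" for A n
      by (induction n) simp_all
    then have "of_real (fps_nth (G ^ i) n) = fps_nth (C G ^ i) n" for i n
      by (metis C_def fps_nth_Abs_fps)
    then show ?thesis
      by (simp add: fps_eq_iff fps_compose_nth) (simp add: C_def fps_compose_nth)
  qed
  have F0: "fps_conv_radius F > 0" and G0: "fps_conv_radius G > 0"
    using F G by (auto simp: has_fps_expansion_def)
  have "(eval_fps (C F) \<circ> eval_fps (C G)) has_fps_expansion (C F oo C G)"
    using F0 G0 G(2)
    by (intro has_fps_expansion_compose eval_fps_has_fps_expansion) (simp_all add: radius, simp add: C_def)
  then have C: "(eval_fps (C F) \<circ> eval_fps (C G)) has_fps_expansion C (F oo G)"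
    by (simp add: compose)
  then have FG0: "fps_conv_radius (F oo G) > 0"
    by (simp add: has_fps_expansion_def radius)
  have lim: "filterlim g (nhds 0) (nhds 0)"
  proof -
    have "g 0 = 0"
      using has_fps_expansion_imp_0_eq_fps_nth_0[OF G(1)] G(2) by simp
    moreover have "isCont g 0"
      using has_fps_expansion_imp_continuous[OF G(1), of UNIV] by simp
    ultimately show ?thesis
      using tendsto_at_iff_tendsto_nhds[of g 0] by (simp add: isCont_def)
  qed
  have lim_of_real: "filterlim (of_real :: real \<Rightarrow> complex) (nhds 0) (nhds 0)"
    using tendsto_of_real[OF filterlim_ident, of "0::real"] by simp
  \<comment> \<open>The complex identity is read at \<open>of_real x\<close>. This needs
    \<open>x\<close> inside the radii of \<open>F oo G\<close> and \<open>G\<close>,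
    \<open>g x\<close> inside that of \<open>F\<close>, and agreement of \<open>f\<close> with its
    series at \<open>g x\<close>, which holds near \<open>0\<close> because \<open>g\<close> tends
    to \<open>0\<close> there.\<close>
  have "eventually (\<lambda>x. eval_fps (F oo G) x = f (g x)) (nhds 0)"
    using near[OF FG0] near[OF G0] filterlim_iff[THEN iffD1, OF lim, rule_format, OF near[OF F0]]
      filterlim_iff[THEN iffD1, OF lim, rule_format, OF conjunct2[OF F[unfolded has_fps_expansion_def]]]
      conjunct2[OF G(1)[unfolded has_fps_expansion_def]]
      filterlim_iff[THEN iffD1, OF lim_of_real, rule_format,
        OF conjunct2[OF C[unfolded has_fps_expansion_def]]]
  proof eventually_elim
    case (elim x)
    then have "complex_of_real (eval_fps (F oo G) x) = of_real (f (g x))"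
      using eval[of x "F oo G"] eval[of x G] eval[of "g x" F] by simp
    then show ?case
      by (simp only: of_real_eq_iff)
  qed
  with FG0 show ?thesis
    by (simp add: has_fps_expansion_def)
qed

lemma has_fps_expansion_higher_deriv:
  fixes f :: "'a :: {banach, real_normed_field} \<Rightarrow> 'a"
  assumes "f has_fps_expansion F"
  shows "(deriv ^^ n) f has_fps_expansion fps_nth_deriv n F"
proof (induction n)
  case (Suc n)
  then show ?case
    using has_fps_expansion_deriv[OF Suc] by (simp add: fps_nth_deriv_commute del: fps_nth_deriv.simps)
qed (use assms in simp)

lemma has_fps_expansion_eventually_differentiable:
  fixes f :: "real \<Rightarrow> real"
  assumes "f has_fps_expansion F"
  shows "eventually (\<lambda>x. f differentiable (at x)) (nhds 0)"
proof -
  have "eventually (\<lambda>x. x \<in> eball 0 (fps_conv_radius F)) (nhds 0)"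
    using assms by (intro eventually_nhds_in_open) (auto simp: has_fps_expansion_def zero_ereal_def)
  \<comment> \<open>Equality with the series at the single point \<open>x\<close> would not transfer
    a derivative; equality on a whole neighbourhood of \<open>x\<close> does.\<close>
  moreover have "eventually (\<lambda>x. eventually (\<lambda>z. eval_fps F z = f z) (nhds x)) (nhds 0)"
    using assms by (simp add: has_fps_expansion_def eventually_eventually)
  ultimately show ?thesis
  proof eventually_elim
    case (elim x)
    then have "(eval_fps F has_field_derivative eval_fps (fps_deriv F) x) (at x)"
      by (intro has_field_derivative_eval_fps) simp
    also have "?this \<longleftrightarrow> (f has_field_derivative eval_fps (fps_deriv F) x) (at x)"
      using elim by (intro DERIV_cong_ev) simp_all
    finally show ?case
      by (auto simp: real_differentiable_def)
  qed
qed

text \<open>Every iterated derivative again has an expansion at \<open>0\<close>, hence is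
  differentiable near \<open>0\<close>. Only finitely many orders below \<open>n\<close> occur, so
  one neighbourhood serves them all.\<close>

lemma has_cumulant_from_expansion:
  assumes "cgf P X has_fps_expansion F"
    and "eventually (\<lambda>\<eta>. integrable P (\<lambda>x. exp (\<eta> * X x))) (nhds 0)"
  shows "has_cumulant P X n (fact n * fps_nth F n)"
proof -
  have "eventually (\<lambda>\<eta>. \<forall>i\<in>{..<n}. (deriv ^^ i) (cgf P X) differentiable at \<eta>) (nhds 0)"
    using has_fps_expansion_eventually_differentiable[OF has_fps_expansion_higher_deriv[OF assms(1)]]
    by (intro eventually_ball_finite) auto
  with assms(2) have "eventually (\<lambda>\<eta>. integrable P (\<lambda>x. exp (\<eta> * X x)) \<and>
      (\<forall>i<n. (deriv ^^ i) (cgf P X) differentiable at \<eta>)) (nhds 0)"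
    by eventually_elim simp
  moreover have "(deriv ^^ n) (cgf P X) 0 = fact n * fps_nth F n"
    using has_fps_expansion_imp_0_eq_fps_nth_0[OF has_fps_expansion_higher_deriv[OF assms(1)]]
    by (simp add: fps_deriv_maclauren_0)
  ultimately show ?thesis
    by (auto simp: has_cumulant_def eventually_nhds_metric dist_real_def)
qed

subsection \<open>Bell polynomials\<close>

text \<open>With the factor \<open>1 / k!\<close> built in, the binomial and multinomial theorems
  lose their coefficients, so that sums over multiplicities become plain products.\<close>

definition divided_power :: "nat \<Rightarrow> 'a::field_char_0 fps \<Rightarrow> 'a fps" where
  "divided_power k F = fps_const (inverse (fact k)) * F ^ k"

lemma divided_power_add:
  "divided_power k (F + G) = (\<Sum>p\<le>k. divided_power p F * divided_power (k - p) G)"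
proof -
  have "fps_const (inverse (fact k)) * (of_nat (k choose p) * F ^ p * G ^ (k - p)) =
      divided_power p F * divided_power (k - p) G" if "p \<le> k" for p
  proof -
    have "inverse (fact k) * of_nat (k choose p) = (inverse (fact p) * inverse (fact (k - p)) :: 'a)"
      using that by (simp add: binomial_fact field_simps)
    then have "fps_const (inverse (fact k)) * of_nat (k choose p) =
        (fps_const (inverse (fact p)) * fps_const (inverse (fact (k - p))) :: 'a fps)"
      by (simp flip: fps_of_nat)
    then show ?thesis
      by (simp only: divided_power_def mult.assoc[symmetric]) (simp only: mult_ac)
  qed
  then show ?thesis
    by (simp only: divided_power_def[of k "F + G"] binomial_ring sum_distrib_left)
      (intro sum.cong, auto)
qed

lemma divided_power_monomial:
  "divided_power p (fps_const c * fps_X ^ i) = fps_const (c ^ p / fact p) * fps_X ^ (i * p)"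
proof -
  have "(fps_const c * fps_X ^ i) ^ p = fps_const (c ^ p) * fps_X ^ (i * p)"
    by (simp only: power_mult_distrib fps_const_power power_mult)
  then show ?thesis
    by (simp add: divided_power_def mult.assoc[symmetric] divide_inverse mult.commute)
qed

text \<open>This is the multinomial theorem. The induction splits off one element \<open>a\<close>,
  whose multiplicity \<open>p\<close> leaves \<open>k - p\<close> to be distributed over
  \<open>A\<close>.\<close>

lemma divided_power_sum:
  assumes "finite A"
  shows "divided_power k (\<Sum>i\<in>A. y i) =
    (\<Sum>j | j \<in> A \<rightarrow>\<^sub>E {0..k} \<and> sum j A = k. \<Prod>i\<in>A. divided_power (j i) (y i))"
  using assms
proof (induction A arbitrary: k)
  case empty
  show ?case
  proof (cases "k = 0")
    case True
    then have "{j. j \<in> {} \<rightarrow>\<^sub>E {0..k} \<and> sum j {} = k} = {\<lambda>x. undefined}"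
      by auto
    with True show ?thesis
      by (simp add: divided_power_def)
  qed (simp add: divided_power_def power_0_left)
next
  case (insert a A)
  let ?I = "\<lambda>A k. {j. j \<in> A \<rightarrow>\<^sub>E {0..k} \<and> sum j A = k}"
  have finite: "finite (?I A l)" for l :: nat
    by (rule finite_subset[OF _ finite_PiE[of A "\<lambda>_. {0..l}"]]) (use insert.hyps in \<open>auto intro: finite_PiE\<close>)
  have "divided_power k (\<Sum>i\<in>insert a A. y i) =
      (\<Sum>p\<le>k. \<Sum>j\<in>?I A (k - p). divided_power p (y a) * (\<Prod>i\<in>A. divided_power (j i) (y i)))"
    using insert by (simp add: divided_power_add sum_distrib_left)
  also have "\<dots> = (\<Sum>(p, j)\<in>(SIGMA p:{..k}. ?I A (k - p)).
      divided_power p (y a) * (\<Prod>i\<in>A. divided_power (j i) (y i)))"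
    using finite by (intro sum.Sigma) simp_all
  also have "\<dots> = (\<Sum>j\<in>?I (insert a A) k. \<Prod>i\<in>insert a A. divided_power (j i) (y i))"
  \<comment> \<open>An index on \<open>insert a A\<close> corresponds to its value at
    \<open>a\<close> together with its restriction to \<open>A\<close>. The restriction takes the
    value \<open>undefined\<close> at \<open>a\<close>, as extensional functions do off their
    domain.\<close>
  proof (rule sum.reindex_cong[where l = "\<lambda>j. (j a, j(a := undefined))"])
    show "inj_on (\<lambda>j. (j a, j(a := undefined))) (?I (insert a A) k)"
      by (rule inj_on_inverseI[where g = "\<lambda>(p, j). j(a := p)"]) simp
    show "(SIGMA p:{..k}. ?I A (k - p)) = (\<lambda>j. (j a, j(a := undefined))) ` ?I (insert a A) k"
    proof (intro equalityI subsetI)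
      fix q assume "q \<in> (SIGMA p:{..k}. ?I A (k - p))"
      then obtain p j where q: "q = (p, j)" "p \<le> k" "j \<in> A \<rightarrow>\<^sub>E {0..k - p}" "sum j A = k - p"
        by auto
      have "sum (j(a := p)) A = k - p"
        using q(4) insert.hyps by (metis (mono_tags, lifting) fun_upd_apply sum.cong)
      then have "j(a := p) \<in> ?I (insert a A) k"
        using q insert.hyps by (auto simp: PiE_iff extensional_def intro: order_trans)
      moreover have "q = ((j(a := p)) a, (j(a := p))(a := undefined))"
        using q insert.hyps by (auto simp: PiE_iff extensional_def)
      ultimately show "q \<in> (\<lambda>j. (j a, j(a := undefined))) ` ?I (insert a A) k"
        by (metis (no_types, lifting) image_eqI)
    next
      fix q assume "q \<in> (\<lambda>j. (j a, j(a := undefined))) ` ?I (insert a A) k"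
      then obtain j where j: "j \<in> ?I (insert a A) k" and q: "q = (j a, j(a := undefined))"
        by blast
      have "sum (j(a := undefined)) A = sum j A"
        using insert.hyps by (intro sum.cong) auto
      moreover have "j i \<le> sum j A" if "i \<in> A" for i
        using that insert.hyps by (intro member_le_sum) auto
      moreover have "sum j A = k - j a" "j a \<le> k"
        using j insert.hyps by auto
      ultimately show "q \<in> (SIGMA p:{..k}. ?I A (k - p))"
        using j q insert.hyps by (auto simp: PiE_iff extensional_def)
    qed
    fix j
    have "(\<Prod>i\<in>A. divided_power ((j(a := undefined)) i) (y i)) = (\<Prod>i\<in>A. divided_power (j i) (y i))"
      using insert.hyps by (intro prod.cong) auto
    then show "(case (j a, j(a := undefined)) of (p, j) \<Rightarrow>
          divided_power p (y a) * (\<Prod>i\<in>A. divided_power (j i) (y i))) =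
        (\<Prod>i\<in>insert a A. divided_power (j i) (y i))"
      using insert.hyps by simp
  qed
  finally show ?case .
qed

lemma fps_power_nth_cong:
  assumes "\<And>i. i \<le> n \<Longrightarrow> fps_nth F i = fps_nth G i"
  shows "fps_nth (F ^ k) n = fps_nth (G ^ k) n"
  using assms
proof (induction k arbitrary: n)
  case (Suc k)
  then show ?case
    by (auto simp: fps_mult_nth intro!: sum.cong)
qed simp

text \<open>
  Expanding the divided power of a sum of monomials sorts the terms by multiplicities, which are
  exactly the indices of the Bell polynomial.
\<close>

lemma partial_bell_conv_fps_power:
  assumes "fps_nth G 0 = 0" and G: "\<And>i. i \<ge> 1 \<Longrightarrow> fps_nth G i = x i / fact i" and "k \<le> n"
  shows "partial_bell n k x = fact n * (fps_nth (G ^ k) n / fact k)"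
proof -
  define L where "L = n - k + 1"
  \<comment> \<open>\<open>G\<close> has no constant term, so coefficients of index above \<open>L\<close> do not reach coefficient \<open>n\<close> of \<open>G ^ k\<close>.\<close>
  define S where "S = (\<Sum>i=1..L. fps_const (x i / fact i) * fps_X ^ i)"
  have S_nth: "fps_nth S i = fps_nth G i" if "i \<le> L" for i
  proof -
    have "fps_nth S i = (\<Sum>l=1..L. if l = i then x l / fact l else 0)"
      unfolding S_def fps_sum_nth by (intro sum.cong) auto
    also have "\<dots> = fps_nth G i"
      using that assms(1) G[of i] by (cases "i = 0") (auto simp: sum.delta)
    finally show ?thesis .
  qed
  \<comment> \<open>Each of the \<open>k\<close> factors is divisible by \<open>fps_X\<close>;
    taking these out lowers the index from \<open>n\<close> to \<open>n - k\<close>, and the shifted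
    series is then read only up to index \<open>n - k\<close>.\<close>
  have power: "fps_nth (A ^ k) n = fps_nth (fps_shift 1 A ^ k) (n - k)" if "fps_nth A 0 = 0" for A :: "real fps"
  proof -
    have "A = fps_X * fps_shift 1 A"
      using that by (simp add: fps_eq_iff)
    then have "A ^ k = fps_X ^ k * fps_shift 1 A ^ k"
      by (metis power_mult_distrib)
    then show ?thesis
      using \<open>k \<le> n\<close> by (simp add: fps_X_power_mult_nth)
  qed
  have "fps_nth (G ^ k) n = fps_nth (fps_shift 1 G ^ k) (n - k)"
    using assms(1) by (rule power)
  also have "\<dots> = fps_nth (fps_shift 1 S ^ k) (n - k)"
    by (rule fps_power_nth_cong) (simp add: S_nth L_def)
  also have "\<dots> = fps_nth (S ^ k) n"
    using S_nth[of 0] assms(1) by (simp add: power)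
  finally have eq: "fps_nth (G ^ k) n / fact k = fps_nth (divided_power k S) n"
    by (simp add: divided_power_def field_simps)
  \<comment> \<open>For each choice of multiplicities the product is a single monomial. Its
    coefficient is the Bell summand without \<open>fact n\<close>, and its degree is the weighted
    sum that the Bell polynomial requires to be \<open>n\<close>.\<close>
  have monomial: "(\<Prod>i=1..L. divided_power (j i) (fps_const (x i / fact i) * fps_X ^ i)) =
      fps_const ((\<Prod>i=1..L. (x i / fact i) ^ j i) / (\<Prod>i=1..L. fact (j i))) *
        fps_X ^ (\<Sum>i=1..L. i * j i)" for j
  proof -
    have "(\<Prod>i=1..L. divided_power (j i) (fps_const (x i / fact i) * fps_X ^ i)) =
        (\<Prod>i=1..L. fps_const ((x i / fact i) ^ j i / fact (j i)) * fps_X ^ (i * j i))"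
      by (simp add: divided_power_monomial)
    also have "\<dots> = (\<Prod>i=1..L. fps_const ((x i / fact i) ^ j i / fact (j i))) * fps_X ^ (\<Sum>i=1..L. i * j i)"
      by (simp add: prod.distrib power_sum)
    also have "(\<Prod>i=1..L. fps_const ((x i / fact i) ^ j i / fact (j i))) =
        fps_const (\<Prod>i=1..L. (x i / fact i) ^ j i / fact (j i))"
      by (induction L) (simp_all add: fps_const_mult[symmetric] del: fps_const_mult)
    finally show ?thesis
      by (simp add: prod_dividef)
  qed
  let ?I = "{j. j \<in> {1..L} \<rightarrow>\<^sub>E {0..k} \<and> sum j {1..L} = k}"
  have fin: "finite ?I"
    by (rule finite_subset[OF _ finite_PiE[of "{1..L}" "\<lambda>_. {0..k}"]]) auto
  have "fps_nth (divided_power k S) n = (\<Sum>j\<in>?I. if (\<Sum>i=1..L. i * j i) = n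
      then (\<Prod>i=1..L. (x i / fact i) ^ j i) / (\<Prod>i=1..L. fact (j i)) else 0)"
    by (simp only: S_def divided_power_sum finite_atLeastAtMost fps_sum_nth monomial)
      (auto simp: fps_X_power_nth intro!: sum.cong)
  also have "\<dots> = (\<Sum>j | j \<in> ?I \<and> (\<Sum>i=1..L. i * j i) = n.
      (\<Prod>i=1..L. (x i / fact i) ^ j i) / (\<Prod>i=1..L. fact (j i)))"
    using fin by (subst sum.inter_filter[symmetric]) simp_all
  finally show ?thesis
    unfolding eq partial_bell_def L_def[symmetric] by (simp add: sum_distrib_left conj_assoc mult_ac)
qed

text \<open>This is the exponential formula: \<open>G ^ i / i!\<close> is the exponential generating
  function of the Bell polynomials with second index \<open>i\<close>. The term \<open>i = 0\<close>
  drops out because \<open>n\<close> is positive.\<close>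

lemma exp_compose_nth_eq_bell:
  assumes "fps_nth G 0 = 0" and "\<And>i. i \<ge> 1 \<Longrightarrow> fps_nth G i = x i / fact i" and "n \<ge> 1"
  shows "fact n * fps_nth (fps_exp l oo G) n = (\<Sum>i=1..n. partial_bell n i x * l ^ i)"
proof -
  have "fps_nth (fps_exp l oo G) n = (\<Sum>i=1..n. l ^ i / fact i * fps_nth (G ^ i) n)"
    using assms(3) by (simp add: fps_compose_nth sum.atLeast_Suc_atMost)
  then show ?thesis
    by (auto simp: partial_bell_conv_fps_power[OF assms(1,2)] sum_distrib_left intro!: sum.cong)
qed

section \<open>Exponential moments and Laguerre polynomials\<close>

text \<open>Divided by \<open>fact p\<close>, the arguments are \<theta>^p, so the generating series
  is \<theta>X / (1 - \<theta>X). Its powers are given by the negative binomial series.\<close>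

lemma bell_factorial_powers:
  assumes "1 \<le> i" "i \<le> n" and "\<theta> \<noteq> 0"
  shows "partial_bell n i (\<lambda>p. fact p * \<theta> ^ p) = fact n * (\<theta> ^ n * real ((n - 1) choose (n - i)) / fact i)"
proof -
  define G :: "real fps" where "G = fps_const \<theta> * fps_X * inverse (1 - fps_const \<theta> * fps_X)"
  have geometric: "inverse (1 - fps_const \<theta> * fps_X) = Abs_fps (\<lambda>k. \<theta> ^ k)"
    using one_minus_const_fps_X_neg_power'[of 1 \<theta>] by simp
  have "fps_nth G p = (if p = 0 then 0 else \<theta> ^ p)" for p
    unfolding G_def geometric by (cases p) (simp_all add: mult.assoc)
  then have "partial_bell n i (\<lambda>p. fact p * \<theta> ^ p) = fact n * (fps_nth (G ^ i) n / fact i)"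
    using assms by (intro partial_bell_conv_fps_power) auto
  also have "G ^ i = fps_const (\<theta> ^ i) * (fps_X ^ i * inverse ((1 - fps_const \<theta> * fps_X) ^ i))"
    unfolding G_def by (simp add: power_mult_distrib fps_inverse_power mult.assoc)
  \<comment> \<open>The factor \<open>fps_X ^ i\<close> moves the index to \<open>n - i\<close>,
    where the negative binomial series of exponent \<open>i\<close> is read off.\<close>
  also have "fps_nth \<dots> n = \<theta> ^ i * (real ((i + (n - i) - 1) choose (n - i)) * \<theta> ^ (n - i))"
    using assms by (subst one_minus_const_fps_X_neg_power') (simp_all add: fps_X_power_mult_nth)
  also have "\<dots> = \<theta> ^ n * real ((n - 1) choose (n - i))"
    using assms by (simp add: power_add[symmetric])
  finally show ?thesis .
qed

lemma bell_sum_eq_p_rayleigh: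
  assumes "n \<ge> 1" "b0 > 0"
  shows "(\<Sum>i=1..n. partial_bell n i (\<lambda>p. fact p * (2 * b0) ^ p) * l ^ i) = p_rayleigh b0 n l"
proof -
  have "partial_bell n i (\<lambda>p. fact p * (2 * b0) ^ p) * l ^ i = (2 * b0) ^ n * fact n *
      ((-1) ^ i * ((real n + (-1)) gchoose (n - i)) * (- l) ^ i / fact i)" if "i \<in> {1..n}" for i
  proof -
    have bell: "partial_bell n i (\<lambda>p. fact p * (2 * b0) ^ p) =
        fact n * ((2 * b0) ^ n * real ((n - 1) choose (n - i)) / fact i)"
      using that assms by (intro bell_factorial_powers) auto
    have choose: "real ((n - 1) choose (n - i)) = (real n + (-1)) gchoose (n - i)"
      using assms by (simp add: binomial_gbinomial)
    have sign: "l ^ i = (-1) ^ i * (- l) ^ i"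
      by (simp add: power_mult_distrib[symmetric])
    show ?thesis
      unfolding bell choose sign by (simp only: mult_ac times_divide_eq_left times_divide_eq_right)
  qed
  \<comment> \<open>The Laguerre sum starts at \<open>0\<close> and the Bell sum at
    \<open>1\<close>. The extra term carries this binomial coefficient, \<open>n - 1\<close> over
    \<open>n\<close>, and vanishes.\<close>
  moreover have "real n + (-1) gchoose n = 0"
  proof -
    have "real n + (-1) = real (n - 1)"
      using assms by simp
    then show ?thesis
      using assms by (simp only: binomial_gbinomial[symmetric]) simp
  qed
  ultimately show ?thesis
    using assms
    by (simp add: p_rayleigh_def gen_laguerre_def sum.atLeast_Suc_atMost[of 0 n] sum_distrib_left
      Gamma_fact[symmetric] add.commute)
qed

subsection \<open>Compound Poisson sums\<close>

text \<open>This is the probability generating function of the Poisson law, from the exponential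
  series. It is used once for the stations of a cluster and once for the clusters.\<close>

lemma suminf_poisson_power:
  fixes q rate :: real
  assumes "rate > 0" "q \<ge> 0"
  shows "(\<Sum>n. ennreal (pmf (poisson_pmf rate) n) * ennreal q ^ n) = ennreal (exp (rate * (q - 1)))"
proof -
  have "(\<lambda>n. (rate * q) ^ n /\<^sub>R fact n * exp (- rate)) sums (exp (rate * q) * exp (- rate))"
    by (intro sums_mult2 exp_converges)
  also have "exp (rate * q) * exp (- rate) = exp (rate * (q - 1))"
    by (simp add: exp_add[symmetric] algebra_simps)
  finally have "(\<Sum>n. ennreal ((rate * q) ^ n /\<^sub>R fact n * exp (- rate))) = ennreal (exp (rate * (q - 1)))"
    using assms by (intro suminf_ennreal_eq) auto
  moreover have "ennreal (pmf (poisson_pmf rate) n) * ennreal q ^ n =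
      ennreal ((rate * q) ^ n /\<^sub>R fact n * exp (- rate))" for n
    using assms by (simp add: ennreal_power ennreal_mult'[symmetric] power_mult_distrib field_simps)
  ultimately show ?thesis
    by simp
qed

lemma suminf_indicator_nat:
  fixes f :: "nat \<Rightarrow> ennreal"
  shows "(\<Sum>n. indicator {real n} (real m) * f n) = f m"
proof -
  have "(\<Sum>n. indicator {real n} (real m) * f n) = (\<Sum>n\<in>{m}. indicator {real n} (real m) * f n)"
    by (intro suminf_finite) (auto simp: indicator_def)
  then show ?thesis
    by simp
qed

context prob_space
begin

lemma nn_integral_indicator_poisson:
  assumes "poisson_distributed M X rate"
  shows "(\<integral>\<^sup>+x. indicator {real n} (real (X x)) \<partial>M) = ennreal (pmf (poisson_pmf rate) n)"
proof -
  have [measurable]: "X \<in> measurable M (count_space UNIV)"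
    using assms by (simp add: poisson_distributed_def)
  have "(\<integral>\<^sup>+x. indicator {real n} (real (X x)) \<partial>M) = (\<integral>\<^sup>+x. indicator {n} (X x) \<partial>M)"
    by (intro nn_integral_cong) (auto simp: indicator_def)
  also have "\<dots> = (\<integral>\<^sup>+x. indicator {n} x \<partial>distr M (count_space UNIV) X)"
    by (subst nn_integral_distr) simp_all
  also have "\<dots> = ennreal (pmf (poisson_pmf rate) n)"
    using assms by (simp add: poisson_distributed_def emeasure_pmf_single)
  finally show ?thesis .
qed

text \<open>
  Writing the random product as a series over the values of the count keeps every factor
  nonnegative and every product finite, so independence and monotone convergence suffice.
\<close>

lemma nn_integral_exp_cluster:
  assumes indep: "indep_vars (\<lambda>_. borel) (source_rv K N H) UNIV"
    and N: "poisson_distributed M (N i) \<mu>" and "\<mu> > 0"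
    and mgf: "\<And>j. (\<integral>\<^sup>+x. ennreal (exp (s * channel_gain H i j x)) \<partial>M) = ennreal m" and "m \<ge> 0"
  shows "(\<integral>\<^sup>+x. (\<Sum>n. indicator {real n} (real (N i x)) *
            (\<Prod>j<n. ennreal (exp (s * channel_gain H i j x)))) \<partial>M) = ennreal (exp (\<mu> * (m - 1)))"
proof -
  have rv: "source_rv K N H a \<in> borel_measurable M" for a
    using indep by (simp add: indep_vars_def)
  have [measurable]: "(\<lambda>x. real (N i x)) \<in> borel_measurable M"
    "channel_gain H i j \<in> borel_measurable M" for j
    using rv[of "Station_Count i"] rv[of "Gain i j"] by (simp_all cong: measurable_cong)
  \<comment> \<open>Once the count is fixed at \<open>n\<close>, only \<open>N i\<close> and the
    first \<open>n\<close> gains occur. Independence of these finitely many sources splits the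
    integral into a Poisson weight times \<open>m ^ n\<close>.\<close>
  have "(\<integral>\<^sup>+x. indicator {real n} (real (N i x)) * (\<Prod>j<n. ennreal (exp (s * channel_gain H i j x))) \<partial>M) =
      ennreal (pmf (poisson_pmf \<mu>) n) * ennreal m ^ n" for n
  proof -
    define I where "I = insert (Station_Count i) (Gain i ` {..<n})"
    define \<psi> :: "source \<Rightarrow> real \<Rightarrow> ennreal" where
      "\<psi> a y = (if a = Station_Count i then indicator {real n} y else ennreal (exp (s * y)))" for a y
    have "indep_vars (\<lambda>_. borel) (\<lambda>a x. \<psi> a (source_rv K N H a x)) I"
      by (rule indep_vars_compose2[OF indep_vars_subset[OF indep]]) (simp_all add: \<psi>_def)
    then have "(\<integral>\<^sup>+x. (\<Prod>a\<in>I. \<psi> a (source_rv K N H a x)) \<partial>M) =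
        (\<Prod>a\<in>I. \<integral>\<^sup>+x. \<psi> a (source_rv K N H a x) \<partial>M)"
      by (intro indep_vars_nn_integral) (simp_all add: I_def)
    moreover have "(\<Prod>a\<in>I. F a) = F (Station_Count i) * (\<Prod>j<n. F (Gain i j))" for F :: "source \<Rightarrow> ennreal"
      unfolding I_def by (subst prod.insert) (auto simp: prod.reindex inj_on_def)
    ultimately show ?thesis
      using nn_integral_indicator_poisson[OF N] by (simp add: \<psi>_def mgf del: pmf_poisson)
  qed
  then show ?thesis
    using assms(3,5) by (simp add: nn_integral_suminf suminf_poisson_power del: pmf_poisson)
qed

text \<open>The second conditioning: distinct clusters use disjoint sets of sources, so the factors
  of the first \<open>k\<close> clusters are independent of each other and of \<open>K\<close>. Each
  has expectation exp(\<mu>(m - 1)), at which the generating function of \<open>K\<close> is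
  evaluated.\<close>

lemma nn_integral_exp_clusters:
  assumes indep: "indep_vars (\<lambda>_. borel) (source_rv K N H) UNIV"
    and K: "poisson_distributed M K l" and "l > 0"
    and N: "\<And>i. poisson_distributed M (N i) \<mu>" and "\<mu> > 0"
    and mgf: "\<And>i j. (\<integral>\<^sup>+x. ennreal (exp (s * channel_gain H i j x)) \<partial>M) = ennreal m" and "m \<ge> 0"
  shows "(\<integral>\<^sup>+x. ennreal (exp (s * (\<Sum>i<K x. \<Sum>j<N i x. channel_gain H i j x))) \<partial>M) =
    ennreal (exp (l * (exp (\<mu> * (m - 1)) - 1)))"
proof -
  define Y where "Y i x = (\<Sum>n. indicator {real n} (real (N i x)) *
    (\<Prod>j<n. ennreal (exp (s * channel_gain H i j x))))" for i x
  have Y: "Y i x = ennreal (exp (s * (\<Sum>j<N i x. channel_gain H i j x)))" for i x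
    by (simp add: Y_def suminf_indicator_nat prod_ennreal exp_sum[symmetric] sum_distrib_left)
  have rv: "source_rv K N H a \<in> borel_measurable M" for a
    using indep by (simp add: indep_vars_def)
  have [measurable]: "(\<lambda>x. real (K x)) \<in> borel_measurable M" "(\<lambda>x. real (N i x)) \<in> borel_measurable M"
    "channel_gain H i j \<in> borel_measurable M" for i j
    using rv[of Cluster_Count] rv[of "Station_Count i"] rv[of "Gain i j"] by (simp_all cong: measurable_cong)
  have [measurable]: "Y i \<in> borel_measurable M" for i
    unfolding Y_def by measurable
  \<comment> \<open>Block \<open>0\<close> holds the cluster count and block \<open>Suc i\<close>
    all sources of cluster \<open>i\<close>. Disjoint blocks of an independent family are
    independent.\<close>
  define B where "B a = (case a of 0 \<Rightarrow> {Cluster_Count} | Suc i \<Rightarrow> insert (Station_Count i) (range (Gain i)))" for a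
  have disjoint: "disjoint_family_on B A" for A
    by (auto simp: disjoint_family_on_def B_def split: nat.splits)
  have blocks: "indep_vars (\<lambda>a. PiM (B a) (\<lambda>_. borel)) (\<lambda>a x. restrict (\<lambda>b. source_rv K N H b x) (B a)) A" for A
    by (rule indep_vars_restrict[OF indep _ disjoint]) simp
  have "(\<integral>\<^sup>+x. indicator {real k} (real (K x)) * (\<Prod>i<k. Y i x) \<partial>M) =
      ennreal (pmf (poisson_pmf l) k) * ennreal (exp (\<mu> * (m - 1))) ^ k" for k
  proof -
    \<comment> \<open>\<open>\<phi> a\<close> looks only at coordinates in \<open>B a\<close>, so
      restricting to the block loses nothing. The series form makes it visibly measurable on the
      product space of the block.\<close>
    define \<phi> :: "nat \<Rightarrow> (source \<Rightarrow> real) \<Rightarrow> ennreal" where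
      "\<phi> a w = (case a of 0 \<Rightarrow> indicator {real k} (w Cluster_Count)
        | Suc i \<Rightarrow> (\<Sum>n. indicator {real n} (w (Station_Count i)) * (\<Prod>j<n. ennreal (exp (s * w (Gain i j))))))" for a w
    have \<phi>_measurable: "\<phi> a \<in> borel_measurable (PiM (B a) (\<lambda>_. borel))" for a
    proof (cases a)
      case 0
      then have [measurable]: "(\<lambda>w. w Cluster_Count) \<in> borel_measurable (PiM (B a) (\<lambda>_. borel :: real measure))"
        by (intro measurable_component_singleton) (simp add: B_def)
      have "\<phi> a = (\<lambda>w. indicator {real k} (w Cluster_Count))"
        by (simp add: \<phi>_def 0 fun_eq_iff)
      then show ?thesis
        by simp
    next
      case (Suc i)
      then have [measurable]: "(\<lambda>w. w (Station_Count i)) \<in> borel_measurable (PiM (B a) (\<lambda>_. borel :: real measure))"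
        "(\<lambda>w. w (Gain i j)) \<in> borel_measurable (PiM (B a) (\<lambda>_. borel :: real measure))" for j
        by (auto intro!: measurable_component_singleton simp: B_def)
      have "\<phi> a = (\<lambda>w. \<Sum>n. indicator {real n} (w (Station_Count i)) *
          (\<Prod>j<n. ennreal (exp (s * w (Gain i j)))))"
        by (simp add: \<phi>_def Suc fun_eq_iff)
      then show ?thesis
        by simp
    qed
    define Z where "Z a x = \<phi> a (restrict (\<lambda>b. source_rv K N H b x) (B a))" for a x
    have Z: "Z 0 = (\<lambda>x. indicator {real k} (real (K x)))" "Z (Suc i) = Y i" for i
      by (simp_all add: fun_eq_iff Z_def \<phi>_def B_def Y_def)
    have "(\<integral>\<^sup>+x. Y i x \<partial>M) = ennreal (exp (\<mu> * (m - 1)))" for i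
      unfolding Y_def by (rule nn_integral_exp_cluster[OF indep N \<open>\<mu> > 0\<close> mgf \<open>m \<ge> 0\<close>])
    moreover have "indep_vars (\<lambda>_. borel) Z {..k}"
      unfolding Z_def by (rule indep_vars_compose2[OF blocks \<phi>_measurable])
    then have "(\<integral>\<^sup>+x. (\<Prod>a\<in>{..k}. Z a x) \<partial>M) = (\<Prod>a\<in>{..k}. \<integral>\<^sup>+x. Z a x \<partial>M)"
      by (intro indep_vars_nn_integral) simp_all
    moreover have "(\<Prod>a\<in>{..k}. F a) = F 0 * (\<Prod>i<k. F (Suc i))" for F :: "nat \<Rightarrow> ennreal"
      by (simp add: prod.lessThan_Suc_shift flip: lessThan_Suc_atMost del: prod.lessThan_Suc)
    ultimately show ?thesis
      by (simp add: Z nn_integral_indicator_poisson[OF K] del: pmf_poisson)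
  qed
  then have "(\<integral>\<^sup>+x. (\<Sum>k. indicator {real k} (real (K x)) * (\<Prod>i<k. Y i x)) \<partial>M) =
      ennreal (exp (l * (exp (\<mu> * (m - 1)) - 1)))"
    using \<open>l > 0\<close> by (simp add: nn_integral_suminf suminf_poisson_power del: pmf_poisson)
  then show ?thesis
    by (simp add: suminf_indicator_nat Y prod_ennreal exp_sum[symmetric] sum_distrib_left)
qed

section \<open>The moment generating function as a power series\<close>

text \<open>The exponential series is integrated term by term. Since \<open>X\<close> is
  nonnegative, the terms at \<open>r\<close> dominate in absolute value those at any
  \<open>s\<close> with \<bar>s\<bar> < r, of either sign.\<close>

lemma mgf_has_fps_expansion:
  fixes X :: "'a \<Rightarrow> real" and a :: "nat \<Rightarrow> real"
  assumes [measurable]: "X \<in> borel_measurable M" and X: "\<And>x. X x \<ge> 0"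
    and "r > 0" and r: "(\<integral>\<^sup>+x. ennreal (exp (r * X x)) \<partial>M) < \<infinity>"
    and a: "\<And>n. (\<integral>\<^sup>+x. ennreal (X x ^ n) \<partial>M) = ennreal (a n)" "\<And>n. a n \<ge> 0"
  shows "(\<lambda>s. \<integral>x. exp (s * X x) \<partial>M) has_fps_expansion Abs_fps (\<lambda>n. a n / fact n)"
proof -
  have int: "integrable M (\<lambda>x. X x ^ n)" and val: "(\<integral>x. X x ^ n \<partial>M) = a n" for n
    using a[of n] nn_integral_eq_integrable[of "\<lambda>x. X x ^ n" M "a n"] X by auto
  \<comment> \<open>At \<open>r\<close> all terms are nonnegative, so sum and integral may be
    exchanged before anything is known to converge; the finite exponential moment then yields
    summability.\<close>
  have "(\<Sum>n. ennreal (a n * r ^ n / fact n)) = (\<Sum>n. \<integral>\<^sup>+x. ennreal ((r * X x) ^ n /\<^sub>R fact n) \<partial>M)"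
  proof (rule suminf_cong)
    fix n
    have "(\<integral>\<^sup>+x. ennreal ((r * X x) ^ n /\<^sub>R fact n) \<partial>M) = (\<integral>\<^sup>+x. ennreal (r ^ n / fact n) * ennreal (X x ^ n) \<partial>M)"
      using X \<open>r > 0\<close> by (intro nn_integral_cong) (simp add: ennreal_mult'[symmetric] power_mult_distrib field_simps)
    also have "\<dots> = ennreal (r ^ n / fact n) * ennreal (a n)"
      by (subst nn_integral_cmult) (simp_all add: a)
    also have "\<dots> = ennreal (a n * r ^ n / fact n)"
      using a \<open>r > 0\<close> by (simp add: ennreal_mult'[symmetric] mult.commute)
    finally show "ennreal (a n * r ^ n / fact n) = (\<integral>\<^sup>+x. ennreal ((r * X x) ^ n /\<^sub>R fact n) \<partial>M)" ..
  qed
  also have "\<dots> = (\<integral>\<^sup>+x. (\<Sum>n. ennreal ((r * X x) ^ n /\<^sub>R fact n)) \<partial>M)"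
    by (intro nn_integral_suminf[symmetric]) simp
  also have "\<dots> = (\<integral>\<^sup>+x. ennreal (exp (r * X x)) \<partial>M)"
    using X \<open>r > 0\<close> by (intro nn_integral_cong suminf_ennreal_eq exp_converges) auto
  finally have summable: "summable (\<lambda>n. a n * r ^ n / fact n)"
    using r a \<open>r > 0\<close> by (intro summable_suminf_not_top) auto
  have sums: "(\<lambda>n. a n / fact n * s ^ n) sums (\<integral>x. exp (s * X x) \<partial>M)" if "\<bar>s\<bar> < r" for s
  proof -
    have norm: "norm ((s * X x) ^ n /\<^sub>R fact n) = \<bar>s\<bar> ^ n / fact n * X x ^ n" for x n
      using X by (simp add: power_mult_distrib power_abs abs_mult field_simps)
    have "(\<lambda>n. \<integral>x. (s * X x) ^ n /\<^sub>R fact n \<partial>M) sums (\<integral>x. (\<Sum>n. (s * X x) ^ n /\<^sub>R fact n) \<partial>M)"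
    proof (rule sums_integral)
      show "integrable M (\<lambda>x. (s * X x) ^ n /\<^sub>R fact n)" for n
        using int by (simp add: power_mult_distrib)
      show "AE x in M. summable (\<lambda>n. norm ((s * X x) ^ n /\<^sub>R fact n))"
        by (rule AE_I2) (rule summable_norm_exp)
      have "a n * \<bar>s\<bar> ^ n / fact n \<le> a n * r ^ n / fact n" for n
        using a that by (intro divide_right_mono mult_left_mono power_mono) auto
      then have "summable (\<lambda>n. a n * \<bar>s\<bar> ^ n / fact n)"
        using a by (intro summable_comparison_test'[OF summable]) auto
      then show "summable (\<lambda>n. \<integral>x. norm ((s * X x) ^ n /\<^sub>R fact n) \<partial>M)"
        unfolding norm by (simp add: val field_simps)
    qed
    then show ?thesis
      by (simp add: power_mult_distrib val exp_def field_simps)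
  qed
  have "eventually (\<lambda>s. \<bar>s\<bar> < r) (nhds (0::real))"
    using \<open>r > 0\<close> by (auto simp: eventually_nhds_metric dist_real_def)
  then show ?thesis
    by (intro has_fps_expansionI, elim eventually_mono) (use sums in simp)
qed

end

section \<open>Cumulants for an arbitrary gain density\<close>

text \<open>The gain law enters only through its moments and one finite exponential moment at a
  positive \<open>r\<close>, so both fading models become instances.\<close>

lemma (in prob_space) has_cumulant_mainlobe_temperature:
  fixes f :: "real \<Rightarrow> real" and a :: "nat \<Rightarrow> real"
  assumes indep: "indep_vars (\<lambda>_. borel) (source_rv K N H) UNIV"
    and K: "poisson_distributed M K l" "l > 0"
    and N: "\<And>i. poisson_distributed M (N i) \<mu>" "\<mu> > 0"
    and dist: "\<And>i j. distributed M lborel (channel_gain H i j) f"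
    and a: "\<And>p. (\<integral>\<^sup>+t. ennreal (f t) * ennreal (t ^ p) \<partial>lborel) = ennreal (a p)" "\<And>p. a p \<ge> 0"
    and r: "r > 0" "(\<integral>\<^sup>+t. ennreal (f t) * ennreal (exp (r * t)) \<partial>lborel) < \<infinity>"
    and "n \<ge> 1"
  shows "has_cumulant M (mainlobe_temperature g \<omega> \<alpha> d K N H) n
    (l * (g * \<omega> * d powr (- \<alpha>)) ^ n * (\<Sum>i=1..n. partial_bell n i a * \<mu> ^ i))"
proof -
  define c where "c = g * \<omega> * d powr (- \<alpha>)"
  define T where "T x = (\<Sum>i<K x. \<Sum>j<N i x. channel_gain H i j x)" for x
  have T: "mainlobe_temperature g \<omega> \<alpha> d K N H x = c * T x" for x
    unfolding mainlobe_temperature_def T_def c_def sum_distrib_left by (intro sum.cong refl) simp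
  have [measurable]: "channel_gain H i j \<in> borel_measurable M" for i j
    using distributed_measurable[OF dist[of i j]] by simp
  have [measurable]: "K \<in> measurable M (count_space UNIV)" "N i \<in> measurable M (count_space UNIV)" for i
    using K N by (auto simp: poisson_distributed_def)
  have T_measurable [measurable]: "T \<in> borel_measurable M"
    unfolding T_def by measurable
  have gain_nonneg: "channel_gain H i j x \<ge> 0" for i j x
    by (simp add: channel_gain_def)
  have moments: "(\<integral>\<^sup>+x. ennreal (channel_gain H i j x ^ p) \<partial>M) = ennreal (a p)" for i j p
    by (subst distributed_nn_integral[OF dist, symmetric]) (simp_all add: a)
  define \<Phi> where "\<Phi> s = (\<integral>x. exp (s * channel_gain H 0 0 x) \<partial>M)" for s
  have eq: "(\<integral>\<^sup>+x. ennreal (exp (s * channel_gain H i j x)) \<partial>M) =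
      (\<integral>\<^sup>+t. ennreal (f t) * ennreal (exp (s * t)) \<partial>lborel)" for s i j
    by (subst distributed_nn_integral[OF dist, symmetric]) simp_all
  have mgf: "(\<integral>\<^sup>+x. ennreal (exp (s * channel_gain H i j x)) \<partial>M) = ennreal (\<Phi> s)" if "s < r" for s i j
  proof -
    have "(\<integral>\<^sup>+x. ennreal (exp (s * channel_gain H 0 0 x)) \<partial>M) \<le>
        (\<integral>\<^sup>+x. ennreal (exp (r * channel_gain H 0 0 x)) \<partial>M)"
      using that gain_nonneg by (intro nn_integral_mono) (auto intro: mult_right_mono)
    also have "\<dots> < \<infinity>"
      using r(2) by (simp add: eq)
    finally have "integrable M (\<lambda>x. exp (s * channel_gain H 0 0 x))"
      by (intro integrableI_nonneg) auto
    then have "(\<integral>\<^sup>+x. ennreal (exp (s * channel_gain H 0 0 x)) \<partial>M) = ennreal (\<Phi> s)"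
      unfolding \<Phi>_def by (intro nn_integral_eq_integral) auto
    then show ?thesis
      by (simp add: eq)
  qed
  have \<Phi>_nonneg: "\<Phi> s \<ge> 0" for s
    unfolding \<Phi>_def by (intro Bochner_Integration.integral_nonneg) simp
  define F where "F = Abs_fps (\<lambda>n. a n / fact n)"
  have F: "\<Phi> has_fps_expansion F"
    unfolding \<Phi>_def F_def
    by (rule mgf_has_fps_expansion[where r = r])
      (use r a gain_nonneg dist in \<open>simp_all add: moments eq\<close>)
  \<comment> \<open>The moment of order \<open>0\<close> is the total mass \<open>1\<close>. Hence
    \<open>F - 1\<close> has no constant term and may be substituted into the exponential
    series.\<close>
  have "ennreal (a 0) = ennreal 1"
    using moments[of 0 0 0] by (simp add: emeasure_space_1)
  then have F0: "fps_nth (F - 1) 0 = 0"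
    by (simp add: F_def)
  define \<kappa> where "\<kappa> \<eta> = l * (exp (\<mu> * (\<Phi> (c * \<eta>) - 1)) - 1)" for \<eta>
  have near: "eventually (\<lambda>\<eta>. c * \<eta> < r) (nhds 0)"
  proof -
    have "((\<lambda>\<eta>. c * \<eta>) \<longlongrightarrow> c * 0) (nhds 0)"
      by (intro tendsto_intros filterlim_ident)
    then show ?thesis
      using order_tendstoD(2)[of "\<lambda>\<eta>. c * \<eta>" 0 "nhds 0" r] r(1) by simp
  qed
  have "integrable M (\<lambda>x. exp (\<eta> * mainlobe_temperature g \<omega> \<alpha> d K N H x)) \<and>
      cgf M (mainlobe_temperature g \<omega> \<alpha> d K N H) \<eta> = \<kappa> \<eta>" if "c * \<eta> < r" for \<eta>
  proof -
    have "(\<integral>\<^sup>+x. ennreal (exp (c * \<eta> * T x)) \<partial>M) = ennreal (exp (\<kappa> \<eta>))"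
      unfolding T_def \<kappa>_def
      by (rule nn_integral_exp_clusters[OF indep K N mgf[OF that] \<Phi>_nonneg])
    then have "integrable M (\<lambda>x. exp (c * \<eta> * T x)) \<and> (\<integral>x. exp (c * \<eta> * T x) \<partial>M) = exp (\<kappa> \<eta>)"
      by (subst (asm) nn_integral_eq_integrable) auto
    then show ?thesis
      by (simp add: cgf_def T mult_ac)
  qed
  then have cgf: "eventually (\<lambda>\<eta>. integrable M (\<lambda>x. exp (\<eta> * mainlobe_temperature g \<omega> \<alpha> d K N H x)) \<and>
      cgf M (mainlobe_temperature g \<omega> \<alpha> d K N H) \<eta> = \<kappa> \<eta>) (nhds 0)"
    by (rule eventually_mono[OF near])
  define E where "E = fps_const l * (((fps_exp \<mu> oo (F - 1)) oo (fps_const c * fps_X)) - 1)"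
  have "(\<lambda>s. exp (\<mu> * (\<Phi> s - 1))) has_fps_expansion (fps_exp \<mu> oo (F - 1))"
    by (rule has_fps_expansion_compose_real[OF has_fps_expansion_exp _ F0])
      (intro has_fps_expansion_diff F has_fps_expansion_1)
  then have "(\<lambda>\<eta>. exp (\<mu> * (\<Phi> (c * \<eta>) - 1))) has_fps_expansion
      ((fps_exp \<mu> oo (F - 1)) oo (fps_const c * fps_X))"
    by (rule has_fps_expansion_compose_real)
      (intro has_fps_expansion_cmult_left has_fps_expansion_fps_X, simp)
  then have "\<kappa> has_fps_expansion E"
    unfolding \<kappa>_def E_def
    by (intro has_fps_expansion_cmult_left has_fps_expansion_diff has_fps_expansion_1)
  moreover have "eventually (\<lambda>\<eta>. \<kappa> \<eta> = cgf M (mainlobe_temperature g \<omega> \<alpha> d K N H) \<eta>) (nhds 0)"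
    using cgf by eventually_elim simp
  ultimately have "cgf M (mainlobe_temperature g \<omega> \<alpha> d K N H) has_fps_expansion E"
    using has_fps_expansion_cong by blast
  then have "has_cumulant M (mainlobe_temperature g \<omega> \<alpha> d K N H) n (fact n * fps_nth E n)"
    using cgf by (intro has_cumulant_from_expansion) (auto elim: eventually_mono)
  moreover have "fact n * fps_nth (fps_exp \<mu> oo (F - 1)) n = (\<Sum>i=1..n. partial_bell n i a * \<mu> ^ i)"
    using F0 \<open>n \<ge> 1\<close> by (intro exp_compose_nth_eq_bell) (auto simp: F_def)
  \<comment> \<open>Substituting \<open>c * \<eta>\<close> multiplies coefficient \<open>n\<close>
    by \<open>c ^ n\<close>, and the subtracted \<open>1\<close> affects only coefficient
    \<open>0\<close>.\<close>
  then have "fact n * fps_nth E n = l * c ^ n * (\<Sum>i=1..n. partial_bell n i a * \<mu> ^ i)"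
    using \<open>n \<ge> 1\<close> unfolding E_def by (simp add: fps_nth_compose_linear flip: mult.assoc)
  ultimately show ?thesis
    by (simp add: c_def)
qed

subsection \<open>Moments of shadowed Rician fading\<close>

lemma nn_integral_power_exp:
  assumes "b > 0"
  shows "(\<integral>\<^sup>+t. ennreal (if t > 0 then t ^ k * exp (- b * t) else 0) \<partial>lborel) = ennreal (fact k / b ^ (k + 1))"
proof -
  have "(\<integral>\<^sup>+t. ennreal (if t > 0 then t ^ k * exp (- b * t) else 0) \<partial>lborel) =
      (\<integral>\<^sup>+t. ennreal (1 / b) * ennreal (erlang_density 0 b t * t ^ k) \<partial>lborel)"
  proof (rule nn_integral_cong_AE)
    show "AE t in lborel. ennreal (if t > 0 then t ^ k * exp (- b * t) else 0) =
        ennreal (1 / b) * ennreal (erlang_density 0 b t * t ^ k)"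
      \<comment> \<open>For \<open>k = 0\<close> the two integrands differ at \<open>t = 0\<close>,
        a null set.\<close>
      using AE_lborel_singleton[of "0::real"]
    proof eventually_elim
      case (elim t)
      then show ?case
        using assms by (auto simp: erlang_density_def ennreal_mult'[symmetric])
    qed
  qed
  also have "\<dots> = ennreal (1 / b) * ennreal (fact k / b ^ k)"
    using nn_integral_erlang_ith_moment[OF assms, of 0 k] by (subst nn_integral_cmult) simp_all
  finally show ?thesis
    using assms by (simp add: ennreal_mult'[symmetric])
qed

section \<open>Convergence of the hypergeometric series\<close>

lemma norm_ratio_cancel:
  fixes x y q s :: real
  assumes "x > 0" "y > 0" "q > 0" "s > 0"
  shows "norm (x / y) / norm (x * q / (s * y)) = s / q"
  using assms by (simp add: field_simps)

text \<open>By the ratio test the series is entire. The lower parameter \<open>1\<close> contributes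
  a second factorial to the denominator.\<close>

lemma sums_hypergeo_1F1:
  assumes "m > 0"
  shows "(\<lambda>k. pochhammer m k / (fact k)\<^sup>2 * x ^ k) sums hypergeo_1F1 m 1 x"
proof -
  have "conv_radius (\<lambda>k. pochhammer m k / (fact k)\<^sup>2) = \<infinity>"
  proof (rule conv_radius_ratio_limit_ereal_nonzero)
    have pos: "pochhammer m k > 0" for k
      using assms by (rule pochhammer_pos)
    have "norm (pochhammer m k / (fact k)\<^sup>2) / norm (pochhammer m (Suc k) / (fact (Suc k))\<^sup>2) =
        (real k + 1) ^ 2 / (m + real k)" for k
      using pos[of k] assms norm_ratio_cancel[of "pochhammer m k" "(fact k)\<^sup>2" "m + real k" "(real k + 1)\<^sup>2"]
      by (simp add: pochhammer_Suc power_mult_distrib add.commute)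
    moreover have "filterlim (\<lambda>k. (real k + 1) ^ 2 / (m + real k)) at_top sequentially"
      using assms by real_asymp
    ultimately show "(\<lambda>k. ereal (norm (pochhammer m k / (fact k)\<^sup>2) / norm (pochhammer m (Suc k) / (fact (Suc k))\<^sup>2)))
        \<longlonglongrightarrow> \<infinity>"
      by (simp add: tendsto_PInfty_eq_at_top)
  qed simp
  then have "summable (\<lambda>k. pochhammer m k / (fact k)\<^sup>2 * x ^ k)"
    by (intro summable_in_conv_radius) simp
  then show ?thesis
    by (simp add: hypergeo_def eval_fps_def pochhammer_fact[symmetric] power2_eq_square summable_sums)
qed

lemma sums_hypergeo_2F1:
  assumes "m > 0" "q > 0" and "\<bar>z\<bar> < 1"
  shows "(\<lambda>k. pochhammer m k * pochhammer q k / (fact k)\<^sup>2 * z ^ k) sums hypergeo_2F1 m q 1 z"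
proof -
  have "conv_radius (\<lambda>k. pochhammer m k * pochhammer q k / (fact k)\<^sup>2) = ereal 1"
  proof (rule conv_radius_ratio_limit_nonzero)
    have pos: "pochhammer m k > 0" "pochhammer q k > 0" for k
      using assms by (simp_all add: pochhammer_pos)
    have "norm (pochhammer m k * pochhammer q k / (fact k)\<^sup>2) /
        norm (pochhammer m (Suc k) * pochhammer q (Suc k) / (fact (Suc k))\<^sup>2) =
        (real k + 1) ^ 2 / ((m + real k) * (q + real k))" for k
      using pos[of k] assms norm_ratio_cancel[of "pochhammer m k * pochhammer q k" "(fact k)\<^sup>2"
        "(m + real k) * (q + real k)" "(real k + 1)\<^sup>2"]
      by (simp add: pochhammer_Suc power_mult_distrib add.commute mult_ac)
    moreover have "(\<lambda>k. (real k + 1) ^ 2 / ((m + real k) * (q + real k))) \<longlonglongrightarrow> 1"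
      using assms by real_asymp
    ultimately show "(\<lambda>k. norm (pochhammer m k * pochhammer q k / (fact k)\<^sup>2) /
        norm (pochhammer m (Suc k) * pochhammer q (Suc k) / (fact (Suc k))\<^sup>2)) \<longlonglongrightarrow> 1"
      by simp
  qed simp_all
  then have "summable (\<lambda>k. pochhammer m k * pochhammer q k / (fact k)\<^sup>2 * z ^ k)"
    using assms by (intro summable_in_conv_radius) simp
  then show ?thesis
    by (simp add: hypergeo_def eval_fps_def pochhammer_fact[symmetric] power2_eq_square summable_sums)
qed

text \<open>The factor exp(ut) only shifts the decay rate to \<open>v\<close>, so one computation
  serves twice: \<open>u = 0\<close> gives the moments, and \<open>p = 0\<close> with positive
  \<open>u\<close> a finite exponential moment. The hypothesis on \<open>w + u\<close> says that w/v
  < 1, where the 2F1 series converges.\<close>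

lemma nn_integral_shadowed_rician:
  fixes \<Omega> b0 m :: real
  defines "w \<equiv> \<Omega> / (2 * b0 * (2 * b0 * m + \<Omega>))"
    and "A \<equiv> ((2 * b0 * m) / (2 * b0 * m + \<Omega>)) powr m"
  assumes "\<Omega> > 0" "b0 > 0" "m > 0" and u: "w + u < 1 / (2 * b0)"
  shows "(\<integral>\<^sup>+t. ennreal (shadowed_rician_density \<Omega> b0 m t) * ennreal (t ^ p * exp (u * t)) \<partial>lborel) =
    ennreal (A / (2 * b0) * fact p / (1 / (2 * b0) - u) ^ (p + 1) *
      hypergeo_2F1 m (real p + 1) 1 (w / (1 / (2 * b0) - u)))"
proof -
  define v where "v = 1 / (2 * b0) - u"
  have "w > 0"
    using assms(3-5) by (simp add: w_def add_pos_pos)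
  then have v: "v > 0" "\<bar>w / v\<bar> < 1"
    using u by (simp_all add: v_def)
  have "A \<ge> 0"
    by (simp add: A_def)
  define C where "C k = A / (2 * b0) * (pochhammer m k / (fact k)\<^sup>2 * w ^ k)" for k
  have C: "C k \<ge> 0" for k
    using \<open>A \<ge> 0\<close> \<open>w > 0\<close> \<open>b0 > 0\<close> pochhammer_pos[OF \<open>m > 0\<close>, of k] by (simp add: C_def)
  have "ennreal (shadowed_rician_density \<Omega> b0 m t) * ennreal (t ^ p * exp (u * t)) =
      (\<Sum>k. ennreal (C k) * ennreal (if t > 0 then t ^ (p + k) * exp (- v * t) else 0))" for t
  proof (cases "t > 0")
    case True
    have "(\<lambda>k. A / (2 * b0) * exp (- t / (2 * b0)) * (t ^ p * exp (u * t)) *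
        (pochhammer m k / (fact k)\<^sup>2 * (w * t) ^ k)) sums
        (A / (2 * b0) * exp (- t / (2 * b0)) * (t ^ p * exp (u * t)) * hypergeo_1F1 m 1 (w * t))"
      by (intro sums_mult sums_hypergeo_1F1 \<open>m > 0\<close>)
    moreover have "exp (- t / (2 * b0)) * exp (u * t) = exp (- v * t)"
      by (simp add: exp_add[symmetric] v_def algebra_simps)
    then have "A / (2 * b0) * exp (- t / (2 * b0)) * (t ^ p * exp (u * t)) *
        (pochhammer m k / (fact k)\<^sup>2 * (w * t) ^ k) = C k * (t ^ (p + k) * exp (- v * t))" for k
      by (simp add: C_def power_mult_distrib power_add mult_ac)
    moreover have "A / (2 * b0) * exp (- t / (2 * b0)) * (t ^ p * exp (u * t)) * hypergeo_1F1 m 1 (w * t) =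
        shadowed_rician_density \<Omega> b0 m t * (t ^ p * exp (u * t))"
      using True by (simp add: shadowed_rician_density_def A_def w_def mult_ac)
    ultimately have "(\<lambda>k. C k * (t ^ (p + k) * exp (- v * t))) sums
        (shadowed_rician_density \<Omega> b0 m t * (t ^ p * exp (u * t)))"
      by simp
    then have "(\<Sum>k. ennreal (C k * (t ^ (p + k) * exp (- v * t)))) =
        ennreal (shadowed_rician_density \<Omega> b0 m t * (t ^ p * exp (u * t)))"
      using True C by (intro suminf_ennreal_eq) auto
    then show ?thesis
      using True C by (simp add: ennreal_mult' ennreal_mult'')
  qed (simp add: shadowed_rician_density_def)
  then have "(\<integral>\<^sup>+t. ennreal (shadowed_rician_density \<Omega> b0 m t) * ennreal (t ^ p * exp (u * t)) \<partial>lborel) =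
      (\<Sum>k. ennreal (C k) * ennreal (fact (p + k) / v ^ (p + k + 1)))"
    using v(1) by (simp only: nn_integral_power_exp nn_integral_cmult nn_integral_suminf)
      (subst nn_integral_suminf, simp, subst nn_integral_cmult, simp, simp only: nn_integral_power_exp)
  also have "\<dots> = (\<Sum>k. ennreal (A / (2 * b0) * fact p / v ^ (p + 1) *
      (pochhammer m k * pochhammer (real p + 1) k / (fact k)\<^sup>2 * (w / v) ^ k)))"
  proof (rule suminf_cong)
    \<comment> \<open>Writing (p + k)! as p! times a Pochhammer symbol turns the integrated 1F1
      terms into 2F1 terms.\<close>
    fix k
    have "fact (p + k) = fact p * pochhammer (real p + 1) k"
      using pochhammer_product'[of "1::real" p k] by (simp add: pochhammer_fact add.commute)
    then have "C k * (fact (p + k) / v ^ (p + k + 1)) = A / (2 * b0) * fact p / v ^ (p + 1) *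
      (pochhammer m k * pochhammer (real p + 1) k / (fact k)\<^sup>2 * (w / v) ^ k)"
      using v(1) by (simp add: C_def power_add power_divide field_simps)
    then show "ennreal (C k) * ennreal (fact (p + k) / v ^ (p + k + 1)) = ennreal (A / (2 * b0) * fact p / v ^ (p + 1) *
        (pochhammer m k * pochhammer (real p + 1) k / (fact k)\<^sup>2 * (w / v) ^ k))"
      using C by (metis ennreal_mult')
  qed
  also have "\<dots> = ennreal (A / (2 * b0) * fact p / v ^ (p + 1) * hypergeo_2F1 m (real p + 1) 1 (w / v))"
    using \<open>A \<ge> 0\<close> \<open>b0 > 0\<close> \<open>m > 0\<close> \<open>w > 0\<close> v
    by (intro suminf_ennreal_eq sums_mult sums_hypergeo_2F1)
      (auto intro!: mult_nonneg_nonneg divide_nonneg_nonneg simp: pochhammer_nonneg)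
  finally show ?thesis
    by (simp add: v_def)
qed

subsection \<open>The cumulants\<close>

theorem lemma6:
  fixes P :: "'a measure"
    and K :: "'a \<Rightarrow> nat" and N :: "nat \<Rightarrow> 'a \<Rightarrow> nat" and H :: "nat \<Rightarrow> nat \<Rightarrow> 'a \<Rightarrow> complex"
    and \<omega> \<alpha> lam\<^sub>c lam\<^sub>B\<^sub>S g r\<^sub>e h d b0 :: real and n :: nat
  assumes "prob_space P"
    and "\<omega> > 0" and "\<alpha> > 2" and "lam\<^sub>c > 0" and "lam\<^sub>B\<^sub>S > 0" and "g > 0" and "r\<^sub>e > 0" and "h > r\<^sub>e"
    and "d > 0" and "d\<^sup>2 + 2 * d * r\<^sub>e * cos (40 * (pi / 180)) + r\<^sub>e\<^sup>2 - h\<^sup>2 = 0"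
    and "b0 > 0"
    and "poisson_distributed P K (40\<^sup>2 * lam\<^sub>c)"
    and "\<And>i. poisson_distributed P (N i) lam\<^sub>B\<^sub>S"
    and "prob_space.indep_vars P (\<lambda>_. borel) (source_rv K N H) UNIV"
    and "n \<ge> 1"
  shows "(rayleigh_fading P H b0 \<longrightarrow>
           has_cumulant P (mainlobe_temperature g \<omega> \<alpha> d K N H) n
             (40\<^sup>2 * g ^ n * \<omega> ^ n * lam\<^sub>c * p_rayleigh b0 n lam\<^sub>B\<^sub>S * d powr (- (real n * \<alpha>)))) \<and>
         (\<forall>\<Omega> m. \<Omega> > 0 \<and> m > 0 \<and> shadowed_rician_fading P H \<Omega> b0 m \<longrightarrow>
           has_cumulant P (mainlobe_temperature g \<omega> \<alpha> d K N H) n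
             (40\<^sup>2 * g ^ n * \<omega> ^ n * lam\<^sub>c * p_shadowed_rician \<Omega> b0 m n lam\<^sub>B\<^sub>S * d powr (- (real n * \<alpha>))))"
proof -
  interpret prob_space P by fact
  have "(d powr (- \<alpha>)) ^ n = d powr (- (real n * \<alpha>))"
    using \<open>d > 0\<close> by (simp add: powr_realpow[symmetric] powr_powr mult.commute)
  then have factor: "(40\<^sup>2 * lam\<^sub>c) * (g * \<omega> * d powr (- \<alpha>)) ^ n * p =
      40\<^sup>2 * g ^ n * \<omega> ^ n * lam\<^sub>c * p * d powr (- (real n * \<alpha>))" for p
    by (simp add: power_mult_distrib mult_ac)
  have "40\<^sup>2 * lam\<^sub>c > 0"
    using \<open>lam\<^sub>c > 0\<close> by simp
  note cumulant = has_cumulant_mainlobe_temperature[OF assms(14,12) this assms(13,5)]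
  show ?thesis
  proof (intro conjI impI allI)
    assume "rayleigh_fading P H b0"
    then have dist: "distributed P lborel (channel_gain H i j) (exponential_density (1 / (2 * b0)))" for i j
      by (simp add: rayleigh_fading_def)
    have moments: "(\<integral>\<^sup>+t. ennreal (exponential_density (1 / (2 * b0)) t) * ennreal (t ^ p) \<partial>lborel) =
        ennreal (fact p * (2 * b0) ^ p)" for p
    proof -
      have "(\<integral>\<^sup>+t. ennreal (exponential_density (1 / (2 * b0)) t) * ennreal (t ^ p) \<partial>lborel) =
          (\<integral>\<^sup>+t. ennreal (exponential_density (1 / (2 * b0)) t * t ^ p) \<partial>lborel)"
        using \<open>b0 > 0\<close> by (intro nn_integral_cong ennreal_mult'[symmetric]) (simp add: erlang_density_def)
      then show ?thesis
        using nn_integral_erlang_ith_moment[of "1 / (2 * b0)" 0 p] \<open>b0 > 0\<close> by (simp add: power_one_over field_simps)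
    qed
    \<comment> \<open>The exponent 1/(4 b0) is half the rate of the density. Tilting by it gives
      twice the exponential density of the halved rate, so the integral is finite.\<close>
    have "(\<integral>\<^sup>+t. ennreal (exponential_density (1 / (2 * b0)) t) * ennreal (exp (1 / (4 * b0) * t)) \<partial>lborel) =
        (\<integral>\<^sup>+t. ennreal 2 * ennreal (exponential_density (1 / (4 * b0)) t) \<partial>lborel)"
    proof (rule nn_integral_cong)
      fix t
      have "exp (- t / (2 * b0)) * exp (t / (4 * b0)) = exp (- t / (4 * b0))"
        by (simp add: exp_add[symmetric] field_simps)
      then have "exponential_density (1 / (2 * b0)) t * exp (1 / (4 * b0) * t) =
          2 * exponential_density (1 / (4 * b0)) t"
        using \<open>b0 > 0\<close> by (auto simp: erlang_density_def)
      then show "ennreal (exponential_density (1 / (2 * b0)) t) * ennreal (exp (1 / (4 * b0) * t)) =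
          ennreal 2 * ennreal (exponential_density (1 / (4 * b0)) t)"
        by (metis ennreal_mult' ennreal_mult'' exp_ge_zero zero_le_numeral)
    qed
    also have "\<dots> = 2 * (\<integral>\<^sup>+t. ennreal (exponential_density (1 / (4 * b0)) t * t ^ 0) \<partial>lborel)"
      by (subst nn_integral_cmult) simp_all
    also have "\<dots> < \<infinity>"
      using nn_integral_erlang_ith_moment[of "1 / (4 * b0)" 0 0] \<open>b0 > 0\<close> by simp
    finally show "has_cumulant P (mainlobe_temperature g \<omega> \<alpha> d K N H) n
        (40\<^sup>2 * g ^ n * \<omega> ^ n * lam\<^sub>c * p_rayleigh b0 n lam\<^sub>B\<^sub>S * d powr (- (real n * \<alpha>)))"
      unfolding factor[symmetric] bell_sum_eq_p_rayleigh[OF \<open>n \<ge> 1\<close> \<open>b0 > 0\<close>, symmetric]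
      by (intro cumulant[OF dist moments, where r = "1 / (4 * b0)"]) (use \<open>b0 > 0\<close> \<open>n \<ge> 1\<close> in simp_all)
  next
    fix \<Omega> m :: real
    assume *: "\<Omega> > 0 \<and> m > 0 \<and> shadowed_rician_fading P H \<Omega> b0 m"
    then have dist: "distributed P lborel (channel_gain H i j) (shadowed_rician_density \<Omega> b0 m)" for i j
      by (simp add: shadowed_rician_fading_def)
    define w where "w = \<Omega> / (2 * b0 * (2 * b0 * m + \<Omega>))"
    have ratio: "w / (1 / (2 * b0)) = \<Omega> / (2 * b0 * m + \<Omega>)"
      using \<open>b0 > 0\<close> by (simp add: w_def)
    have less_1: "\<Omega> / (2 * b0 * m + \<Omega>) < 1"
    proof -
      have "2 * b0 * m > 0"
        using * \<open>b0 > 0\<close> by simp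
      then show ?thesis
        using * by (subst divide_less_eq_1_pos) auto
    qed
    have w: "w < 1 / (2 * b0)"
      using ratio less_1 \<open>b0 > 0\<close> by (simp add: field_simps)
    \<comment> \<open>Half the gap between \<open>w\<close> and the rate 1/(2 b0) keeps
      \<open>w + r\<close> strictly below that rate.\<close>
    define r where "r = (1 / (2 * b0) - w) / 2"
    have r: "r > 0" "w + r < 1 / (2 * b0)"
      using w by (simp_all add: r_def field_simps)
    have moments: "(\<integral>\<^sup>+t. ennreal (shadowed_rician_density \<Omega> b0 m t) * ennreal (t ^ p) \<partial>lborel) =
        ennreal (shadowed_rician_moment \<Omega> b0 m p)" for p
      using nn_integral_shadowed_rician[of \<Omega> b0 m 0 p] * w \<open>b0 > 0\<close> ratio
      by (simp add: w_def shadowed_rician_moment_def Gamma_fact[symmetric] add.commute power_one_over field_simps)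
    have nonneg: "shadowed_rician_moment \<Omega> b0 m p \<ge> 0" for p
    proof -
      have "hypergeo_2F1 m (real p + 1) 1 (\<Omega> / (2 * b0 * m + \<Omega>)) \<ge> 0"
        using * less_1 \<open>b0 > 0\<close>
        by (intro sums_le[OF _ sums_zero sums_hypergeo_2F1])
          (auto intro!: mult_nonneg_nonneg divide_nonneg_nonneg add_pos_pos add_nonneg_nonneg simp: pochhammer_nonneg)
      then show ?thesis
        using \<open>b0 > 0\<close> by (simp add: shadowed_rician_moment_def Gamma_real_nonneg)
    qed
    have "(\<integral>\<^sup>+t. ennreal (shadowed_rician_density \<Omega> b0 m t) * ennreal (exp (r * t)) \<partial>lborel) < \<infinity>"
      using nn_integral_shadowed_rician[of \<Omega> b0 m r 0] * r \<open>b0 > 0\<close> by (simp add: w_def)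
    then show "has_cumulant P (mainlobe_temperature g \<omega> \<alpha> d K N H) n
        (40\<^sup>2 * g ^ n * \<omega> ^ n * lam\<^sub>c * p_shadowed_rician \<Omega> b0 m n lam\<^sub>B\<^sub>S * d powr (- (real n * \<alpha>)))"
      unfolding factor[symmetric] p_shadowed_rician_def
      by (rule cumulant[OF dist moments nonneg r(1) _ \<open>n \<ge> 1\<close>])
  qed
qed

end
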